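(* Consider the doubly quadratic inequality constrained piecewise quadratic program $$\begin{aligned}\min_{x\in\mathbb{R}^n}\quad & \psi(x)=\tfrac12 x^TP^0x+(p^0)^Tx-\max_{1\le i\le k_2}\left\{\tfrac12 x^TP^ix+(p^i)^Tx+\alpha_i\right\}\\ \text{subject to}\quad & \beta_1\le \tfrac12 x^TQx+c^Tx\le\beta_2\quad\text{and}\quad Ax\le b,\end{aligned}$$ where $P^0,P^1,\ldots,P^{k_2},Q\in\mathbb{R}^{n\times n}$ are symmetric matrices, $A\in\mathbb{R}^{m\times n}$, $p^0,p^1,\ldots,p^{k_2},c\in\mathbb{R}^n$, $b\in\mathbb{R}^m$, $\alpha_i$ are real scalars, and $\beta_1\le\beta_2$ (the possibilities $\beta_1=-\infty$, or $\beta_2=+\infty$, or $\beta_1=\beta_2$ are allowed). This problem has finitely many B-stationary values under either one of the following two assumptions: (a) Abadie's constraint qualification holds at all B-stationary points; (b) one of the two quadratic inequalities cannot be satisfied strictly on the polyhedron $Z=\{x\in\mathbb{R}^n\mid Ax\le b\}$ (i.e., either there is no $x\in Z$ with $\tfrac12x^TQx+c^Tx>\beta_1$, or there is no $x\in Z$ with $\tfrac12x^TQx+c^Tx<\beta_2$).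
   Context: Let $X$ denote the feasible set of the problem. The Bouligand tangent cone $\mathcal{T}(x;X)$ of $X$ at $x\in X$ is the set of vectors $d\in\mathbb{R}^n$ for which there exist a sequence $\{x^k\}\subseteq X$ converging to $x$ and a sequence of positive scalars $\{\tau_k\}$ converging to $0$ such that $d=\lim_{k\to\infty}(x^k-x)/\tau_k$. With $\psi'(\bar x;d)=\lim_{\delta\downarrow0}\frac{\psi(\bar x+\delta d)-\psi(\bar x)}{\delta}$, a vector $\bar x\in X$ is a B-stationary point of the problem if $\psi'(\bar x;d)\ge0$ for all $d\in\mathcal{T}(\bar x;X)$; in this case $\psi(\bar x)$ is called a B-stationary value. Abadie's constraint qualification holds at $\bar x\in X$ if the tangent cone equals the linearization cone: $$\mathcal{T}(\bar x;X)=\left\{v\in\mathbb{R}^n \;\middle|\; \begin{array}{ll} v^T(Q\bar x+c)\ge0 & \text{if } \tfrac12\bar x^TQ\bar x+c^T\bar x=\beta_1\\ v^T(Q\bar x+c)\le0 & \text{if } \tfrac12\bar x^TQ\bar x+c^T\bar x=\beta_2\\ A_{i\bullet}v\le0 & \text{for all } i \text{ with } A_{i\bullet}\bar x=b_i\end{array}\right\},$$ where $A_{i\bullet}$ is the $i$-th row of $A$. *)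

theory Defs
  imports "HOL-Analysis.Analysis"
begin

definition quadratic :: "real^'n^'n \<Rightarrow> real^'n \<Rightarrow> real^'n \<Rightarrow> real" where
  "quadratic P p x = 1/2 * (x \<bullet> (P *v x)) + p \<bullet> x"

text \<open>The index \<open>0\<close> carries the quadratic outside the maximum, and the indices \<open>1, \<dots>, k\<close>
  the pieces of the maximum (so \<open>\<alpha> 0\<close> is not used). The maximum is meaningful for \<open>k \<ge> 1\<close>.\<close>

definition pq_objective ::
    "nat \<Rightarrow> (nat \<Rightarrow> real^'n^'n) \<Rightarrow> (nat \<Rightarrow> real^'n) \<Rightarrow> (nat \<Rightarrow> real) \<Rightarrow> real^'n \<Rightarrow> real" where
  "pq_objective k P p \<alpha> x =
     quadratic (P 0) (p 0) x - Max ((\<lambda>i. quadratic (P i) (p i) x + \<alpha> i) ` {1..k})"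

definition polyhedral_set :: "real^'n^'m \<Rightarrow> real^'m \<Rightarrow> (real^'n) set" where
  "polyhedral_set A b = {x. \<forall>i. (A *v x) $ i \<le> b $ i}"

text \<open>The bounds are extended reals, so that a bound may be absent.\<close>

definition feasible_set ::
    "real^'n^'n \<Rightarrow> real^'n \<Rightarrow> ereal \<Rightarrow> ereal \<Rightarrow> real^'n^'m \<Rightarrow> real^'m \<Rightarrow> (real^'n) set" where
  "feasible_set Q c \<beta>1 \<beta>2 A b =
     {x \<in> polyhedral_set A b. \<beta>1 \<le> ereal (quadratic Q c x) \<and> ereal (quadratic Q c x) \<le> \<beta>2}"

definition tangent_cone :: "'a::real_normed_vector \<Rightarrow> 'a set \<Rightarrow> 'a set" where
  "tangent_cone x X =
     {d. \<exists>xs \<tau>. (\<forall>k. xs k \<in> X) \<and> xs \<longlonglongrightarrow> x \<and> (\<forall>k. \<tau> k > 0) \<and> \<tau> \<longlonglongrightarrow> 0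
            \<and> (\<lambda>k. (xs k - x) /\<^sub>R \<tau> k) \<longlonglongrightarrow> d}"

text \<open>As with \<^const>\<open>Lim\<close> in general, the value is unspecified where the one-sided limit does
  not exist; for a difference of a quadratic and a maximum of finitely many quadratics it always
  exists.\<close>

definition dir_deriv :: "('a::real_normed_vector \<Rightarrow> real) \<Rightarrow> 'a \<Rightarrow> 'a \<Rightarrow> real" where
  "dir_deriv \<psi> x d = Lim (at_right 0) (\<lambda>\<delta>. (\<psi> (x + \<delta> *\<^sub>R d) - \<psi> x) / \<delta>)"

definition B_stationary :: "('a::real_normed_vector \<Rightarrow> real) \<Rightarrow> 'a set \<Rightarrow> 'a \<Rightarrow> bool" where
  "B_stationary \<psi> X x \<longleftrightarrow> x \<in> X \<and> (\<forall>d \<in> tangent_cone x X. dir_deriv \<psi> x d \<ge> 0)"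

definition B_stationary_values :: "('a::real_normed_vector \<Rightarrow> real) \<Rightarrow> 'a set \<Rightarrow> real set" where
  "B_stationary_values \<psi> X = {\<psi> x | x. B_stationary \<psi> X x}"

text \<open>For symmetric \<open>Q\<close>, the vector \<open>Q *v x + c\<close> is the gradient of \<^term>\<open>quadratic Q c\<close> at \<open>x\<close>.\<close>

definition linearization_cone ::
    "real^'n^'n \<Rightarrow> real^'n \<Rightarrow> ereal \<Rightarrow> ereal \<Rightarrow> real^'n^'m \<Rightarrow> real^'m \<Rightarrow> real^'n \<Rightarrow> (real^'n) set" where
  "linearization_cone Q c \<beta>1 \<beta>2 A b x =
     {v. (ereal (quadratic Q c x) = \<beta>1 \<longrightarrow> v \<bullet> (Q *v x + c) \<ge> 0)
       \<and> (ereal (quadratic Q c x) = \<beta>2 \<longrightarrow> v \<bullet> (Q *v x + c) \<le> 0)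
       \<and> (\<forall>i. row i A \<bullet> x = b $ i \<longrightarrow> row i A \<bullet> v \<le> 0)}"

definition Abadie_CQ ::
    "real^'n^'n \<Rightarrow> real^'n \<Rightarrow> ereal \<Rightarrow> ereal \<Rightarrow> real^'n^'m \<Rightarrow> real^'m \<Rightarrow> real^'n \<Rightarrow> bool" where
  "Abadie_CQ Q c \<beta>1 \<beta>2 A b x \<longleftrightarrow>
     tangent_cone x (feasible_set Q c \<beta>1 \<beta>2 A b) = linearization_cone Q c \<beta>1 \<beta>2 A b x"

end

theory Submission
  imports Defs "HOL-Computational_Algebra.Polynomial"
begin

text \<open>Near a B-stationary point \<open>x\<close> the objective lies below each piece
  \<open>f\<^sub>j = quadratic (P 0 - P j) (p 0 - p j) - \<alpha> j\<close> that attains the maximum at \<open>x\<close>, with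
  equality at \<open>x\<close>; hence the gradient of \<open>f\<^sub>j\<close> is nonnegative on the whole tangent cone
  (\<open>dir_deriv_le_piece\<close>). There are finitely many pieces \<open>j\<close> and finitely many sets \<open>I\<close> of
  active rows, so it is enough to show that, for fixed \<open>j\<close> and \<open>I\<close>, the single quadratic function
  \<open>f = f\<^sub>j\<close> takes finitely many values at such points. Let \<open>V\<close> be the space of vectors orthogonal
  to the rows in \<open>I\<close>. Only directions \<open>v \<in> V\<close> for which both \<open>v\<close> and \<open>-v\<close> are tangent are used:
  the gradient of \<open>f\<close> vanishes on them, and no signs of multipliers matter.

  Abadie's qualification makes every \<open>v \<in> V\<close> orthogonal to the gradient of
  \<open>q = quadratic Q c\<close> such a direction (if no bound on \<open>q\<close> is active, every \<open>v \<in> V\<close>), so there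
  is a multiplier \<open>s\<close> for which \<open>x\<close> is a critical point of \<open>L\<^sub>s = f + s (q - \<beta>)\<close> on the affine space
  \<open>x + V\<close>. The points critical for a given \<open>s\<close> solve a linear system, and \<open>L\<^sub>s\<close> has one value \<open>\<Phi>(s)\<close>
  on all of them; on the quadric \<open>q = \<beta>\<close> this is the value of \<open>f\<close>. The system depends linearly on
  \<open>s\<close>, and outside a finite set of parameters any of its solutions lies on a rational curve of
  solutions (\<open>solution_extends_to_rational_family\<close>). Thus \<open>\<Phi>\<close> is a rational function, and by the
  envelope theorem along a curve through \<open>x\<close> its derivative at the multiplier of \<open>x\<close> is
  \<open>q(x) - \<beta> = 0\<close>. A rational function with infinitely many critical points is constant, so in any
  case only finitely many values arise (\<open>finite_critical_values_on_quadric\<close>).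

  If one of the quadratic inequalities is never strict on the polyhedron, the feasible set consists
  of minimizers of \<open>q\<close> or of \<open>-q\<close> over the polyhedron. Then the gradient of \<open>q\<close> vanishes on \<open>V\<close> at
  both of two feasible points \<open>x\<close>, \<open>y\<close> with the same active rows, so \<open>q\<close> is constant on the line
  through them and \<open>\<plusminus>(y - x)\<close> is tangent at both. If both are B-stationary, then
  \<open>f(x) = f(y)\<close> because the gradients of \<open>f\<close> at both ends vanish along \<open>y - x\<close>
  (\<open>equal_values_on_face_of_minimizers\<close>).\<close>

section \<open>Linear systems with a parameter\<close>

text \<open>Gaussian elimination without division, carried out on the polynomial entries. The polynomial
  \<open>d\<close> is the product of the pivots and, if elimination ends with an equation \<open>0 = r\<close>, of that \<open>r\<close>:
  away from its zeros the system specializes as it does over the field of rational functions. The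
  curve can be led through a prescribed solution because the unknowns without a pivot may be given
  arbitrary constant values.\<close>

lemma solution_extends_to_rational_family:
  fixes M :: "'i \<Rightarrow> 'j \<Rightarrow> real poly" and r :: "'i \<Rightarrow> real poly"
  assumes "finite J"
  shows "\<exists>d. d \<noteq> 0 \<and> (\<forall>s0 u0. poly d s0 \<noteq> 0 \<longrightarrow>
    (\<forall>i\<in>I. (\<Sum>j\<in>J. poly (M i j) s0 * u0 j) = poly (r i) s0) \<longrightarrow>
    (\<exists>Y. (\<forall>j\<in>J. poly (Y j) s0 / poly d s0 = u0 j) \<and>
      (\<forall>s. poly d s \<noteq> 0 \<longrightarrow>
        (\<forall>i\<in>I. (\<Sum>j\<in>J. poly (M i j) s * (poly (Y j) s / poly d s)) = poly (r i) s))))"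
  using assms
proof (induction J arbitrary: M r rule: finite_induct)
  case empty
  show ?case
  proof (cases "\<forall>i\<in>I. r i = 0")
    case True
    then show ?thesis by (intro exI[of _ 1]) auto
  next
    case False
    \<comment> \<open>The system is inconsistent wherever \<open>r i\<close> does not vanish.\<close>
    then obtain i where i: "i \<in> I" "r i \<noteq> 0" by blast
    show ?thesis by (rule exI[of _ "r i"]) (use i in auto)
  qed
next
  case (insert l J)
  show ?case
  proof (cases "\<forall>i\<in>I. M i l = 0")
    case True
    from insert.IH[of M r] obtain d where d: "d \<noteq> 0"
      and ext: "\<And>s0 u0. poly d s0 \<noteq> 0 \<Longrightarrow>
        \<forall>i\<in>I. (\<Sum>j\<in>J. poly (M i j) s0 * u0 j) = poly (r i) s0 \<Longrightarrow>
        \<exists>Y. (\<forall>j\<in>J. poly (Y j) s0 / poly d s0 = u0 j) \<and>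
          (\<forall>s. poly d s \<noteq> 0 \<longrightarrow>
            (\<forall>i\<in>I. (\<Sum>j\<in>J. poly (M i j) s * (poly (Y j) s / poly d s)) = poly (r i) s))"
      by blast
    show ?thesis
    proof (intro exI[of _ d] conjI allI impI d)
      fix s0 u0
      assume s0: "poly d s0 \<noteq> 0"
        and u0: "\<forall>i\<in>I. (\<Sum>j\<in>insert l J. poly (M i j) s0 * u0 j) = poly (r i) s0"
      have "\<forall>i\<in>I. (\<Sum>j\<in>J. poly (M i j) s0 * u0 j) = poly (r i) s0"
        using u0 True insert.hyps by simp
      from ext[OF s0 this] obtain Y where
        Y: "\<forall>j\<in>J. poly (Y j) s0 / poly d s0 = u0 j"
        and sol: "\<forall>s. poly d s \<noteq> 0 \<longrightarrow>
            (\<forall>i\<in>I. (\<Sum>j\<in>J. poly (M i j) s * (poly (Y j) s / poly d s)) = poly (r i) s)"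
        by blast
      \<comment> \<open>The unknown \<open>l\<close> is free, so it may keep its value along the whole family.\<close>
      define Z where "Z = Y(l := smult (u0 l) d)"
      have ZJ: "Z j = Y j" if "j \<in> J" for j
        using that insert.hyps by (auto simp: Z_def)
      have Zl: "poly (Z l) s0 / poly d s0 = u0 l"
        using s0 by (simp add: Z_def)
      show "\<exists>Y. (\<forall>j\<in>insert l J. poly (Y j) s0 / poly d s0 = u0 j) \<and>
          (\<forall>s. poly d s \<noteq> 0 \<longrightarrow> (\<forall>i\<in>I. (\<Sum>j\<in>insert l J.
            poly (M i j) s * (poly (Y j) s / poly d s)) = poly (r i) s))"
        using Y sol True insert.hyps Zl by (intro exI[of _ Z]) (auto simp: ZJ)
    qed
  next
    case False
    then obtain k where k: "k \<in> I" "M k l \<noteq> 0" by blast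
    define a where "a = M k l"
    have a: "a \<noteq> 0" using k a_def by simp
    define M' where "M' i j = a * M i j - M i l * M k j" for i j
    define r' where "r' i = a * r i - M i l * r k" for i
    from insert.IH[of M' r'] obtain d where d: "d \<noteq> 0"
      and ext: "\<And>s0 u0. poly d s0 \<noteq> 0 \<Longrightarrow>
        \<forall>i\<in>I. (\<Sum>j\<in>J. poly (M' i j) s0 * u0 j) = poly (r' i) s0 \<Longrightarrow>
        \<exists>Y. (\<forall>j\<in>J. poly (Y j) s0 / poly d s0 = u0 j) \<and>
          (\<forall>s. poly d s \<noteq> 0 \<longrightarrow>
            (\<forall>i\<in>I. (\<Sum>j\<in>J. poly (M' i j) s * (poly (Y j) s / poly d s)) = poly (r' i) s))"
      by blast
    have elim: "(\<Sum>j\<in>J. poly (M' i j) s * u j)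
        = poly a s * (\<Sum>j\<in>J. poly (M i j) s * u j)
          - poly (M i l) s * (\<Sum>j\<in>J. poly (M k j) s * u j)" for i s u
      by (simp add: M'_def sum_distrib_left sum_subtractf algebra_simps)
    show ?thesis
    proof (intro exI[of _ "a * d"] conjI allI impI)
      show "a * d \<noteq> 0" using a d by simp
      fix s0 u0
      assume "poly (a * d) s0 \<noteq> 0"
        and u0: "\<forall>i\<in>I. (\<Sum>j\<in>insert l J. poly (M i j) s0 * u0 j) = poly (r i) s0"
      then have as0: "poly a s0 \<noteq> 0" and ds0: "poly d s0 \<noteq> 0" by auto
      have u0': "(\<Sum>j\<in>J. poly (M i j) s0 * u0 j) = poly (r i) s0 - poly (M i l) s0 * u0 l"
        if "i \<in> I" for i
        using u0 that insert.hyps by (simp add: algebra_simps)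
      have "\<forall>i\<in>I. (\<Sum>j\<in>J. poly (M' i j) s0 * u0 j) = poly (r' i) s0"
        using k by (simp add: elim u0' r'_def a_def[symmetric]) (simp add: algebra_simps)
      from ext[OF ds0 this] obtain Y where
        Y: "\<forall>j\<in>J. poly (Y j) s0 / poly d s0 = u0 j"
        and sol: "\<forall>s. poly d s \<noteq> 0 \<longrightarrow>
            (\<forall>i\<in>I. (\<Sum>j\<in>J. poly (M' i j) s * (poly (Y j) s / poly d s)) = poly (r' i) s)"
        by blast
      \<comment> \<open>Back substitution into the pivot equation \<open>k\<close>.\<close>
      define Z where "Z j = (if j = l then d * r k - (\<Sum>j\<in>J. M k j * Y j) else a * Y j)" for j
      have ZJ: "poly (Z j) s / poly (a * d) s = poly (Y j) s / poly d s"
        if "j \<in> J" "poly (a * d) s \<noteq> 0" for j s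
        using that insert.hyps by (auto simp: Z_def)
      have Zl: "poly (Z l) s / poly (a * d) s
          = (poly (r k) s - (\<Sum>j\<in>J. poly (M k j) s * (poly (Y j) s / poly d s))) / poly a s"
        if "poly (a * d) s \<noteq> 0" for s
        using that by (simp add: Z_def poly_sum sum_divide_distrib[symmetric] field_simps)
      have "\<forall>j\<in>insert l J. poly (Z j) s0 / poly (a * d) s0 = u0 j"
      proof
        fix j assume j: "j \<in> insert l J"
        show "poly (Z j) s0 / poly (a * d) s0 = u0 j"
        proof (cases "j = l")
          case True
          have "(\<Sum>j\<in>J. poly (M k j) s0 * (poly (Y j) s0 / poly d s0))
              = (\<Sum>j\<in>J. poly (M k j) s0 * u0 j)"
            using Y by (intro sum.cong) auto
          then have "poly (Z l) s0 / poly (a * d) s0 = u0 l"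
            using Zl[of s0] as0 ds0 u0'[OF k(1)] by (simp add: a_def)
          with True show ?thesis by simp
        next
          case False
          then show ?thesis using j ZJ[of j s0] Y as0 ds0 by auto
        qed
      qed
      moreover have "(\<Sum>j\<in>insert l J. poly (M i j) s * (poly (Z j) s / poly (a * d) s)) = poly (r i) s"
        if i: "i \<in> I" and s: "poly (a * d) s \<noteq> 0" for s i
      proof -
        have as: "poly a s \<noteq> 0" and ds: "poly d s \<noteq> 0" using s by auto
        define S where "S i = (\<Sum>j\<in>J. poly (M i j) s * (poly (Y j) s / poly d s))" for i
        have "(\<Sum>j\<in>J. poly (M i j) s * (poly (Z j) s / poly (a * d) s)) = S i"
          unfolding S_def
        proof (intro sum.cong refl)
          fix j assume "j \<in> J"
          show "poly (M i j) s * (poly (Z j) s / poly (a * d) s)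
              = poly (M i j) s * (poly (Y j) s / poly d s)"
            by (simp only: ZJ[OF \<open>j \<in> J\<close> s])
        qed
        then have eq: "(\<Sum>j\<in>insert l J. poly (M i j) s * (poly (Z j) s / poly (a * d) s))
            = poly (M i l) s * ((poly (r k) s - S k) / poly a s) + S i"
          unfolding sum.insert[OF insert.hyps] Zl[OF s] by (simp add: S_def)
        have "poly a s * S i - poly (M i l) s * S k = poly (r' i) s"
          using sol[rule_format, OF ds i] unfolding elim S_def .
        then have "poly (M i l) s * (poly (r k) s - S k) + poly a s * S i = poly a s * poly (r i) s"
          by (simp add: r'_def algebra_simps)
        with as show ?thesis unfolding eq by (simp add: field_simps)
      qed
      ultimately show "\<exists>Y. (\<forall>j\<in>insert l J. poly (Y j) s0 / poly (a * d) s0 = u0 j) \<and>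
          (\<forall>s. poly (a * d) s \<noteq> 0 \<longrightarrow> (\<forall>i\<in>I. (\<Sum>j\<in>insert l J.
            poly (M i j) s * (poly (Y j) s / poly (a * d) s)) = poly (r i) s))"
        by blast
    qed
  qed
qed

section \<open>Rational functions of one variable\<close>

text \<open>Only powers of one fixed polynomial are allowed as denominators, so that sums and products
  have the same exceptional points; nothing is said about the values at the zeros of \<open>d\<close>.\<close>

definition rational_off_zeros :: "real poly \<Rightarrow> (real \<Rightarrow> real) \<Rightarrow> bool" where
  "rational_off_zeros d g \<longleftrightarrow> (\<exists>N k. \<forall>s. poly d s \<noteq> 0 \<longrightarrow> g s = poly N s / poly d s ^ k)"

lemma rational_off_zeros_frac: "rational_off_zeros d (\<lambda>s. poly N s / poly d s)"
  unfolding rational_off_zeros_def by (intro exI[of _ N] exI[of _ 1]) simp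

lemma rational_off_zeros_poly: "rational_off_zeros d (\<lambda>s. poly N s)"
  unfolding rational_off_zeros_def by (intro exI[of _ N] exI[of _ 0]) simp

lemma rational_off_zeros_const: "rational_off_zeros d (\<lambda>s. c)"
  using rational_off_zeros_poly[of d "[:c:]"] by simp

lemma rational_off_zeros_id: "rational_off_zeros d (\<lambda>s. s)"
  using rational_off_zeros_poly[of d "[:0,1:]"] by simp

lemma rational_off_zeros_add:
  assumes "rational_off_zeros d f" "rational_off_zeros d g"
  shows "rational_off_zeros d (\<lambda>s. f s + g s)"
proof -
  from assms obtain N k N' k' where
    "\<And>s. poly d s \<noteq> 0 \<Longrightarrow> f s = poly N s / poly d s ^ k"
    "\<And>s. poly d s \<noteq> 0 \<Longrightarrow> g s = poly N' s / poly d s ^ k'"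
    unfolding rational_off_zeros_def by blast
  then show ?thesis unfolding rational_off_zeros_def
    by (intro exI[of _ "N * d ^ k' + N' * d ^ k"] exI[of _ "k + k'"])
      (simp add: poly_power power_add add_divide_distrib)
qed

lemma rational_off_zeros_mult:
  assumes "rational_off_zeros d f" "rational_off_zeros d g"
  shows "rational_off_zeros d (\<lambda>s. f s * g s)"
proof -
  from assms obtain N k N' k' where
    "\<And>s. poly d s \<noteq> 0 \<Longrightarrow> f s = poly N s / poly d s ^ k"
    "\<And>s. poly d s \<noteq> 0 \<Longrightarrow> g s = poly N' s / poly d s ^ k'"
    unfolding rational_off_zeros_def by blast
  then show ?thesis unfolding rational_off_zeros_def
    by (intro exI[of _ "N * N'"] exI[of _ "k + k'"]) (simp add: power_add)
qed

lemma rational_off_zeros_sum: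
  assumes "\<And>i. i \<in> S \<Longrightarrow> rational_off_zeros d (f i)"
  shows "rational_off_zeros d (\<lambda>s. \<Sum>i\<in>S. f i s)"
  using assms by (induction S rule: infinite_finite_induct)
    (auto intro: rational_off_zeros_const rational_off_zeros_add)

text \<open>The numerator of the derivative is a polynomial with infinitely many zeros, so it is zero.\<close>

lemma rational_constant_if_infinitely_many_critical_points:
  assumes g: "rational_off_zeros d g"
    and inf: "infinite {s. poly d s \<noteq> 0 \<and> (g has_real_derivative 0) (at s)}"
  shows "\<exists>C. \<forall>s. poly d s \<noteq> 0 \<longrightarrow> g s = C"
proof -
  have d: "d \<noteq> 0"
  proof
    assume "d = 0"
    then have "{s. poly d s \<noteq> 0 \<and> (g has_real_derivative 0) (at s)} = {}" by simp
    with inf show False by (metis finite.emptyI)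
  qed
  from g obtain N k where gN: "\<And>s. poly d s \<noteq> 0 \<Longrightarrow> g s = poly N s / poly d s ^ k"
    unfolding rational_off_zeros_def by blast
  define D where "D = d ^ k"
  have gD: "g s = poly N s / poly D s" and D0: "poly D s \<noteq> 0" if "poly d s \<noteq> 0" for s
    using gN that by (auto simp: D_def poly_power)
  define R where "R = pderiv N * D - N * pderiv D"
  have ev: "eventually (\<lambda>t. poly d t \<noteq> 0) (nhds s)" if "poly d s \<noteq> 0" for s
  proof -
    have "open {t. poly d t \<noteq> 0}"
      by (intro open_Collect_neq continuous_intros)
    then show ?thesis using that by (auto simp: eventually_nhds)
  qed
  have deriv: "(g has_real_derivative poly R s / (poly D s)\<^sup>2) (at s)" if s: "poly d s \<noteq> 0" for s
  proof -
    have "((\<lambda>t. poly N t / poly D t) has_real_derivative poly R s / (poly D s)\<^sup>2) (at s)"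
      using D0[OF s] by (auto intro!: derivative_eq_intros simp: R_def power2_eq_square)
    moreover have "eventually (\<lambda>t. g t = poly N t / poly D t) (nhds s)"
      using ev[OF s] by eventually_elim (rule gD)
    ultimately show ?thesis
      by (subst DERIV_cong_ev[OF refl _ refl]) auto
  qed
  have "{s. poly d s \<noteq> 0 \<and> (g has_real_derivative 0) (at s)} \<subseteq> {s. poly R s = 0}"
    using DERIV_unique[OF deriv] D0 by fastforce
  with inf have "infinite {s. poly R s = 0}" using finite_subset by blast
  then have R: "R = 0" using poly_roots_finite by blast
  have "finite {s. poly d s = 0}" using d by (rule poly_roots_finite)
  then obtain s0 where s0: "poly d s0 \<noteq> 0"
    by (metis (mono_tags, lifting) UNIV_eq_I infinite_UNIV_char_0 mem_Collect_eq)
  obtain e where e: "e > 0" "\<And>t. dist t s0 < e \<Longrightarrow> poly d t \<noteq> 0"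
    using ev[OF s0] unfolding eventually_nhds_metric by blast
  \<comment> \<open>\<open>g\<close> is constant on an interval, hence \<open>N\<close> is a constant multiple of \<open>D\<close> there, hence
    everywhere: this carries the constant across the zeros of \<open>d\<close>.\<close>
  have const: "g t = g s0" if t: "t \<in> ball s0 e" for t
  proof (rule has_derivative_zero_unique[of "ball s0 e" g, OF _ _ t])
    show "convex (ball s0 e)" by simp
    show "(g has_derivative (\<lambda>h. 0)) (at x within ball s0 e)" if "x \<in> ball s0 e" for x
    proof -
      have "(g has_real_derivative 0) (at x)"
        using deriv[of x] e(2)[of x] that R by (simp add: dist_commute)
      then show ?thesis
        by (auto simp: has_field_derivative_def lambda_zero intro: has_derivative_at_withinI)
    qed
    show "s0 \<in> ball s0 e" using e by simp
  qed
  have "ball s0 e \<subseteq> {t. poly (N - smult (g s0) D) t = 0}"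
  proof
    fix t assume t: "t \<in> ball s0 e"
    then have "poly d t \<noteq> 0" using e(2) by (simp add: dist_commute)
    then show "t \<in> {t. poly (N - smult (g s0) D) t = 0}"
      using const[OF t] gD[of t] D0[of t] by (simp add: field_simps)
  qed
  moreover have "infinite (ball s0 e)"
    using e(1) by (simp add: ball_eq_greaterThanLessThan infinite_Ioo)
  ultimately have "infinite {t. poly (N - smult (g s0) D) t = 0}" using finite_subset by blast
  then have "N - smult (g s0) D = 0" using poly_roots_finite by blast
  then have "poly N s = g s0 * poly D s" for s
    by (metis eq_iff_diff_eq_0 poly_smult)
  then show ?thesis using gD D0 by (intro exI[of _ "g s0"]) auto
qed

section \<open>Quadratic functions\<close>

lemma quadratic_add:
  assumes "transpose P = P"
  shows "quadratic P p (x + h) = quadratic P p x + (P *v x + p) \<bullet> h + 1/2 * (h \<bullet> (P *v h))"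
proof -
  have "h \<bullet> (P *v x) = x \<bullet> (P *v h)"
    by (metis assms dot_lmul_matrix inner_commute transpose_matrix_vector)
  then show ?thesis
    by (simp add: quadratic_def matrix_vector_right_distrib inner_add_left inner_add_right
        inner_commute field_simps)
qed

lemma quadratic_diff:
  "quadratic (P - R) (p - r) x = quadratic P p x - quadratic R r x"
  by (simp add: quadratic_def matrix_vector_mult_diff_rdistrib inner_diff_left inner_diff_right
      field_simps)

lemma transpose_diff: "transpose (P - R) = transpose P - transpose (R :: real^'n^'m)"
  by (simp add: transpose_def vec_eq_iff)

lemma continuous_on_quadratic: "continuous_on S (quadratic P p)"
  unfolding quadratic_def by (intro continuous_intros)

lemma rational_off_zeros_quadratic:
  assumes "\<And>i. rational_off_zeros d (\<lambda>s. x s $ i)"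
  shows "rational_off_zeros d (\<lambda>s. quadratic P p (x s))"
  unfolding quadratic_def inner_vec_def matrix_vector_mult_def
  by (simp only: vec_lambda_beta inner_real_def)
    (intro rational_off_zeros_add rational_off_zeros_mult rational_off_zeros_sum
      rational_off_zeros_const assms)

section \<open>Critical values of a quadratic function on a quadric\<close>

text \<open>This is where finiteness comes from. The parameter is the multiplier \<open>\<mu>\<close> of the constraint
  \<open>quadratic Q c x = \<beta>\<close>. The matrix \<open>P + \<mu> Q\<close>, compressed to \<open>span B\<close>, may be singular for every
  \<open>\<mu>\<close>, so the critical point need not be a function of \<open>\<mu>\<close>; but the value of the Lagrangian \<open>L\<close> is,
  and this value is a rational function with derivative zero at every multiplier that occurs,
  except possibly at the zeros of \<open>d\<close>.\<close>

lemma finite_critical_values_on_quadric: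
  fixes P Q :: "real^'n^'n" and B :: "(real^'n) set"
  assumes P: "transpose P = P" and Q: "transpose Q = Q" and B: "finite B"
  shows "finite {quadratic P p x | x \<mu>. x - x0 \<in> span B \<and> quadratic Q c x = \<beta>
    \<and> (\<forall>v\<in>span B. (P *v x + p + \<mu> *\<^sub>R (Q *v x + c)) \<bullet> v = 0)}"
proof -
  define crit where "crit s x \<longleftrightarrow> x - x0 \<in> span B
    \<and> (\<forall>v\<in>span B. (P *v x + p + s *\<^sub>R (Q *v x + c)) \<bullet> v = 0)" for s x
  define L where "L s x = quadratic P p x + s * (quadratic Q c x - \<beta>)" for s x
  define val where "val s = {quadratic P p x | x. crit s x \<and> quadratic Q c x = \<beta>}" for s

  \<comment> \<open>The second-order expansion of \<open>L s\<close> at a critical point, combined with the change of the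
    parameter. For \<open>t = s\<close> it is symmetric in two critical points, which makes \<open>L s\<close> constant on
    them; for \<open>t\<close> near \<open>s\<close> it gives the derivative of the critical value.\<close>
  have step: "L t y - L s x
      = 1/2 * ((y - x) \<bullet> (P *v (y - x) + s *\<^sub>R (Q *v (y - x)))) + (t - s) * (quadratic Q c y - \<beta>)"
    if "crit s x" "y - x0 \<in> span B" for s t x y
  proof -
    define h where "h = y - x"
    have y: "y = x + h" by (simp add: h_def)
    have "(y - x0) - (x - x0) \<in> span B" using that unfolding crit_def by (blast intro: span_diff)
    then have "h \<in> span B" by (simp add: h_def)
    then have "(P *v x + p) \<bullet> h + s * ((Q *v x + c) \<bullet> h) = 0"
      using that(1) unfolding crit_def by (metis inner_add_left inner_scaleR_left)
    then show ?thesis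
      unfolding h_def[symmetric]
      unfolding L_def y quadratic_add[OF P] quadratic_add[OF Q]
      by (simp add: inner_add_right field_simps)
  qed
  have const: "L s x = L s y" if "crit s x" "crit s y" for s x y
  proof -
    have "L s y - L s x = L s x - L s y"
      using step[of s x y s] step[of s y x s] that
      by (simp add: crit_def matrix_vector_mult_diff_distrib inner_diff_left inner_diff_right
          inner_add_right algebra_simps)
    then show ?thesis by simp
  qed
  have val_L: "val s \<subseteq> {L s x}" if "crit s x" for s x
  proof
    fix z assume "z \<in> val s"
    then obtain y where y: "crit s y" "quadratic Q c y = \<beta>" "z = quadratic P p y"
      by (auto simp: val_def)
    then have "z = L s y" by (simp add: L_def)
    with const[OF that y(1)] show "z \<in> {L s x}" by simp
  qed
  have finite_val: "finite (val s)" for s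
  proof (cases "\<exists>x. crit s x")
    case True
    then show ?thesis using val_L finite_subset by blast
  next
    case False
    then show ?thesis by (simp add: val_def)
  qed

  define pt where "pt u = x0 + (\<Sum>b\<in>B. u b *\<^sub>R b)" for u :: "real^'n \<Rightarrow> real"
  have pt_span: "pt u - x0 \<in> span B" for u
    unfolding pt_def add_diff_cancel_left' by (intro span_sum span_scale span_base)
  have pt_ex: "\<exists>u. x = pt u" if "x - x0 \<in> span B" for x
    using that B by (auto simp: span_finite pt_def algebra_simps)
  \<comment> \<open>In coordinates with respect to \<open>B\<close>, criticality is a linear system whose entries are
    polynomials of degree at most one in the multiplier.\<close>
  define M where "M b b' = [:b \<bullet> (P *v b'), b \<bullet> (Q *v b'):]" for b b' :: "real^'n"
  define r where "r b = [:- (b \<bullet> (P *v x0 + p)), - (b \<bullet> (Q *v x0 + c)):]" for b :: "real^'n"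
  have crit_pt: "crit s (pt u) \<longleftrightarrow> (\<forall>b\<in>B. (\<Sum>b'\<in>B. poly (M b b') s * u b') = poly (r b) s)" for s u
  proof -
    have eq: "(P *v pt u + p + s *\<^sub>R (Q *v pt u + c)) \<bullet> b
        = (\<Sum>b'\<in>B. poly (M b b') s * u b') - poly (r b) s" for b
      by (simp add: pt_def M_def r_def matrix_vector_right_distrib inner_add_left inner_add_right
          matrix_vector_mult_scaleR linear_sum[OF matrix_vector_mul_linear] o_def
          inner_sum_left inner_sum_right inner_commute[of b] sum_distrib_left sum.distrib
          algebra_simps)
    have "(\<forall>v\<in>span B. (P *v pt u + p + s *\<^sub>R (Q *v pt u + c)) \<bullet> v = 0)
        \<longleftrightarrow> (\<forall>b\<in>B. (P *v pt u + p + s *\<^sub>R (Q *v pt u + c)) \<bullet> b = 0)"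
      using orthogonal_to_span[where S = B] by (auto simp: orthogonal_def span_base)
    then show ?thesis by (simp add: crit_def pt_span eq)
  qed
  from solution_extends_to_rational_family[OF B, of B M r] obtain d where d: "d \<noteq> 0"
    and ext: "\<And>s0 u0. poly d s0 \<noteq> 0 \<Longrightarrow> crit s0 (pt u0) \<Longrightarrow>
        \<exists>Y. (\<forall>j\<in>B. poly (Y j) s0 / poly d s0 = u0 j) \<and>
          (\<forall>s. poly d s \<noteq> 0 \<longrightarrow> crit s (pt (\<lambda>b. poly (Y b) s / poly d s)))"
    unfolding crit_pt by blast

  have curve: "\<exists>Y. pt (\<lambda>b. poly (Y b) s0 / poly d s0) = x
      \<and> (\<forall>s. poly d s \<noteq> 0 \<longrightarrow> crit s (pt (\<lambda>b. poly (Y b) s / poly d s)))"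
    if s0: "poly d s0 \<noteq> 0" and x: "crit s0 x" for s0 x
  proof -
    obtain u where u: "x = pt u" using pt_ex x crit_def by blast
    with ext[OF s0, of u] x obtain Y where "\<forall>j\<in>B. poly (Y j) s0 / poly d s0 = u j"
      "\<forall>s. poly d s \<noteq> 0 \<longrightarrow> crit s (pt (\<lambda>b. poly (Y b) s / poly d s))" by blast
    then show ?thesis unfolding u by (intro exI[of _ Y]) (simp add: pt_def)
  qed

  \<comment> \<open>The multipliers that occur, except for the finitely many zeros of \<open>d\<close>.\<close>
  define \<Lambda> where "\<Lambda> = {s. poly d s \<noteq> 0 \<and> val s \<noteq> {}}"
  have "finite (\<Union>s\<in>\<Lambda>. val s)"
  proof (cases "finite \<Lambda>")
    case True
    then show ?thesis using finite_val by blast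
  next
    case False
    then obtain s1 where "s1 \<in> \<Lambda>" by (metis ex_in_conv finite.emptyI)
    then obtain x1 where "poly d s1 \<noteq> 0" "crit s1 x1" by (auto simp: \<Lambda>_def val_def)
    with curve obtain Y1 where
      Y1: "\<And>s. poly d s \<noteq> 0 \<Longrightarrow> crit s (pt (\<lambda>b. poly (Y1 b) s / poly d s))" by blast
    \<comment> \<open>One fixed curve shows that the critical value is rational. Its derivative at \<open>s0\<close> is
      computed along another curve, which passes through the given point of the quadric.\<close>
    define \<Phi> where "\<Phi> s = L s (pt (\<lambda>b. poly (Y1 b) s / poly d s))" for s
    have "rational_off_zeros d (\<lambda>s. pt (\<lambda>b. poly (Y1 b) s / poly d s) $ i)" for i
      unfolding pt_def vector_add_component sum_component vector_scaleR_component real_scaleR_def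
      by (intro rational_off_zeros_add rational_off_zeros_mult rational_off_zeros_sum
          rational_off_zeros_const rational_off_zeros_frac)
    then have rat: "rational_off_zeros d \<Phi>"
      unfolding \<Phi>_def L_def diff_conv_add_uminus
      by (intro rational_off_zeros_add rational_off_zeros_mult rational_off_zeros_const
          rational_off_zeros_id rational_off_zeros_quadratic)
    have deriv: "(\<Phi> has_real_derivative 0) (at s0)" if s0: "s0 \<in> \<Lambda>" for s0
    proof -
      have ds0: "poly d s0 \<noteq> 0" using s0 by (simp add: \<Lambda>_def)
      from s0 obtain x where x: "crit s0 x" "quadratic Q c x = \<beta>"
        by (auto simp: \<Lambda>_def val_def)
      from curve[OF ds0 x(1)] obtain Y where
        Y0: "pt (\<lambda>b. poly (Y b) s0 / poly d s0) = x"
        and Y: "\<And>s. poly d s \<noteq> 0 \<Longrightarrow> crit s (pt (\<lambda>b. poly (Y b) s / poly d s))" by blast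
      define \<gamma> where "\<gamma> s = pt (\<lambda>b. poly (Y b) s / poly d s)" for s
      have \<gamma>0: "\<gamma> s0 = x" using Y0 by (simp add: \<gamma>_def)
      have "(\<gamma> has_vector_derivative (\<Sum>b\<in>B.
          ((poly (pderiv (Y b)) s0 * poly d s0 - poly (Y b) s0 * poly (pderiv d) s0)
            / (poly d s0 * poly d s0)) *\<^sub>R b)) (at s0)"
        unfolding \<gamma>_def pt_def
        by (rule derivative_eq_intros refl | use ds0 in force)+
      then obtain w where w: "(\<gamma> has_vector_derivative w) (at s0)" by blast
      have quot: "((\<lambda>s. (\<gamma> s - x) /\<^sub>R (s - s0)) \<longlongrightarrow> w) (at s0)"
      proof (rule LIM_zero_cancel, rule tendsto_norm_zero_cancel)
        have eq: "norm ((\<gamma> s - x - (s - s0) *\<^sub>R w) /\<^sub>R \<bar>s - s0\<bar>)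
            = norm ((\<gamma> s - x) /\<^sub>R (s - s0) - w)" if "s \<noteq> s0" for s
        proof -
          have "(\<gamma> s - x) /\<^sub>R (s - s0) - w = (\<gamma> s - x - (s - s0) *\<^sub>R w) /\<^sub>R (s - s0)"
            using that by (simp add: scaleR_diff_right)
          then show ?thesis by simp
        qed
        have "((\<lambda>s. norm ((\<gamma> s - x - (s - s0) *\<^sub>R w) /\<^sub>R \<bar>s - s0\<bar>)) \<longlongrightarrow> 0) (at s0)"
          using w unfolding has_vector_derivative_def has_derivative_at_within \<gamma>0 real_norm_def
          by (intro tendsto_norm_zero) blast
        then show "((\<lambda>s. norm ((\<gamma> s - x) /\<^sub>R (s - s0) - w)) \<longlongrightarrow> 0) (at s0)"
        proof (rule Lim_transform_eventually)
          show "eventually (\<lambda>s. norm ((\<gamma> s - x - (s - s0) *\<^sub>R w) /\<^sub>R \<bar>s - s0\<bar>)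
              = norm ((\<gamma> s - x) /\<^sub>R (s - s0) - w)) (at s0)"
            unfolding eventually_at_filter
          proof (intro always_eventually allI impI)
            fix s assume "s \<noteq> s0"
            then show "norm ((\<gamma> s - x - (s - s0) *\<^sub>R w) /\<^sub>R \<bar>s - s0\<bar>)
              = norm ((\<gamma> s - x) /\<^sub>R (s - s0) - w)" by (rule eq)
          qed
        qed
      qed
      have lim: "(\<gamma> \<longlongrightarrow> x) (at s0)"
        using has_vector_derivative_continuous[OF w] \<gamma>0 by (simp add: continuous_within)
      have qlim: "((\<lambda>s. quadratic Q c (\<gamma> s)) \<longlongrightarrow> quadratic Q c x) (at s0)"
        by (rule continuous_on_tendsto_compose[OF continuous_on_quadratic[of UNIV] lim]) auto
      have "((\<lambda>s. 1/2 * ((\<gamma> s - x) \<bullet> (P *v ((\<gamma> s - x) /\<^sub>R (s - s0))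
            + s0 *\<^sub>R (Q *v ((\<gamma> s - x) /\<^sub>R (s - s0)))))
          + (quadratic Q c (\<gamma> s) - \<beta>))
        \<longlongrightarrow> 1/2 * ((x - x) \<bullet> (P *v w + s0 *\<^sub>R (Q *v w))) + (quadratic Q c x - \<beta>)) (at s0)"
        by (intro tendsto_intros lim quot qlim
            bounded_linear.tendsto[OF matrix_vector_mul_bounded_linear])
      then have "((\<lambda>s. 1/2 * ((\<gamma> s - x) \<bullet> (P *v ((\<gamma> s - x) /\<^sub>R (s - s0))
            + s0 *\<^sub>R (Q *v ((\<gamma> s - x) /\<^sub>R (s - s0)))))
          + (quadratic Q c (\<gamma> s) - \<beta>)) \<longlongrightarrow> 0) (at s0)"
        using x(2) by simp
      moreover have "eventually (\<lambda>s. 1/2 * ((\<gamma> s - x) \<bullet> (P *v ((\<gamma> s - x) /\<^sub>R (s - s0))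
            + s0 *\<^sub>R (Q *v ((\<gamma> s - x) /\<^sub>R (s - s0)))))
          + (quadratic Q c (\<gamma> s) - \<beta>) = (\<Phi> s - \<Phi> s0) / (s - s0)) (at s0)"
      proof -
        have "eventually (\<lambda>s. poly d s \<noteq> 0) (at s0)"
          using tendsto_imp_eventually_ne[OF isContD[OF poly_isCont] ds0] .
        moreover have "eventually (\<lambda>s. s \<noteq> s0) (at s0)"
          by (simp add: eventually_at_filter)
        ultimately show ?thesis
        proof eventually_elim
          case (elim s)
          have "\<Phi> s = L s (\<gamma> s)" "\<Phi> s0 = L s0 x"
            unfolding \<Phi>_def \<gamma>_def
            using const[OF Y1 Y] const[OF Y1 x(1)] elim ds0 by blast+
          then have eq: "\<Phi> s - \<Phi> s0 = 1/2 * ((\<gamma> s - x) \<bullet> (P *v (\<gamma> s - x) + s0 *\<^sub>R (Q *v (\<gamma> s - x))))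
              + (s - s0) * (quadratic Q c (\<gamma> s) - \<beta>)"
            using step[OF x(1), of "\<gamma> s" s] pt_span by (simp add: \<gamma>_def)
          define h where "h = \<gamma> s - x"
          define k where "k = h /\<^sub>R (s - s0)"
          have hk: "h = (s - s0) *\<^sub>R k" using elim by (simp add: k_def)
          have "P *v h = (s - s0) *\<^sub>R (P *v k)" "Q *v h = (s - s0) *\<^sub>R (Q *v k)"
            unfolding hk by (rule matrix_vector_mult_scaleR)+
          then have "h \<bullet> (P *v h + s0 *\<^sub>R (Q *v h)) = (s - s0) * (h \<bullet> (P *v k + s0 *\<^sub>R (Q *v k)))"
            by (simp add: inner_add_right distrib_left mult.left_commute)
          then have "\<Phi> s - \<Phi> s0 = (s - s0) * (1/2 * (h \<bullet> (P *v k + s0 *\<^sub>R (Q *v k)))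
              + (quadratic Q c (\<gamma> s) - \<beta>))"
            unfolding eq h_def[symmetric] by (simp only: ring_distribs mult.left_commute)
          then show ?case
            using elim unfolding h_def[symmetric] k_def[symmetric] by simp
        qed
      qed
      ultimately show ?thesis
        unfolding has_field_derivative_iff by (rule Lim_transform_eventually)
    qed
    have "infinite {s. poly d s \<noteq> 0 \<and> (\<Phi> has_real_derivative 0) (at s)}"
      using deriv by (intro infinite_super[OF _ False]) (auto simp: \<Lambda>_def)
    from rational_constant_if_infinitely_many_critical_points[OF rat this] obtain C where
      C: "\<And>s. poly d s \<noteq> 0 \<Longrightarrow> \<Phi> s = C" by blast
    have "(\<Union>s\<in>\<Lambda>. val s) \<subseteq> {C}"
      using val_L[OF Y1] C by (fastforce simp: \<Lambda>_def \<Phi>_def)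
    then show ?thesis using finite_subset by blast
  qed
  moreover have "finite (\<Union>s\<in>{s. poly d s = 0}. val s)"
    using d finite_val by (intro finite_UN_I poly_roots_finite) auto
  moreover have "{quadratic P p x | x \<mu>. x - x0 \<in> span B \<and> quadratic Q c x = \<beta>
    \<and> (\<forall>v\<in>span B. (P *v x + p + \<mu> *\<^sub>R (Q *v x + c)) \<bullet> v = 0)}
    \<subseteq> (\<Union>s\<in>\<Lambda>. val s) \<union> (\<Union>s\<in>{s. poly d s = 0}. val s)"
    by (auto simp: \<Lambda>_def val_def crit_def)
  ultimately show ?thesis by (meson finite_UnI finite_subset)
qed


text \<open>Lagrange multiplier rule for one linear constraint on a subspace.\<close>

lemma multiplier_exists:
  fixes w g :: "'a::real_inner"
  assumes V: "subspace V" and w: "\<And>v. v \<in> V \<Longrightarrow> g \<bullet> v = 0 \<Longrightarrow> w \<bullet> v = 0"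
  shows "\<exists>\<mu>. \<forall>v\<in>V. (w + \<mu> *\<^sub>R g) \<bullet> v = 0"
proof (cases "\<forall>v\<in>V. g \<bullet> v = 0")
  case True
  then show ?thesis using w by (intro exI[of _ 0]) simp
next
  case False
  then obtain u where u: "u \<in> V" "g \<bullet> u \<noteq> 0" by blast
  show ?thesis
  proof (intro exI[of _ "- (w \<bullet> u) / (g \<bullet> u)"] ballI)
    fix v assume "v \<in> V"
    then have "w \<bullet> (v - ((g \<bullet> v) / (g \<bullet> u)) *\<^sub>R u) = 0"
      using u by (intro w subspace_diff subspace_scale V) (simp_all add: inner_diff_right)
    then show "(w + (- (w \<bullet> u) / (g \<bullet> u)) *\<^sub>R g) \<bullet> v = 0"
      using u(2) by (simp add: inner_diff_right inner_diff_left inner_add_left field_simps)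
  qed
qed

section \<open>Stationarity for a piece of the objective\<close>

text \<open>The lowest-order nonzero coefficient decides the sign. With \<open>eventual_maximum_exists\<close> this
  gives, along every ray, one piece that attains the maximum near the starting point.\<close>

lemma quadratic_polynomial_eventually_signed:
  fixes a b c :: real
  shows "eventually (\<lambda>t. a + b * t + c * t\<^sup>2 \<ge> 0) (at_right 0)
       \<or> eventually (\<lambda>t. a + b * t + c * t\<^sup>2 \<le> 0) (at_right 0)"
proof -
  have pos: "eventually (\<lambda>t::real. t > 0) (at_right 0)" by (simp add: eventually_at_filter)
  have lim: "((\<lambda>t::real. u + t * v t) \<longlongrightarrow> u + 0 * v 0) (at_right 0)"
    if "isCont v 0" for u :: real and v
    by (intro tendsto_intros) (use that in \<open>auto simp: isCont_def intro: tendsto_within_subset\<close>)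
  have sgn: "eventually (\<lambda>t. u + t * v t \<ge> 0) (at_right 0) \<or> eventually (\<lambda>t. u + t * v t \<le> 0) (at_right 0)"
    if "u \<noteq> 0" "isCont v 0" for u and v :: "real \<Rightarrow> real"
  proof (cases "u > 0")
    case True
    then have "eventually (\<lambda>t. 0 < u + t * v t) (at_right 0)"
      by (intro order_tendstoD(1)[OF lim[OF that(2)]]) simp
    then show ?thesis by (intro disjI1) (auto elim: eventually_mono)
  next
    case False
    then have "u < 0" using that by simp
    then have "eventually (\<lambda>t. u + t * v t < 0) (at_right 0)"
      by (intro order_tendstoD(2)[OF lim[OF that(2)]]) simp
    then show ?thesis by (intro disjI2) (auto elim: eventually_mono)
  qed
  consider "a \<noteq> 0" | "a = 0" "b \<noteq> 0" | "a = 0" "b = 0" by blast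
  then show ?thesis
  proof cases
    case 1
    have "isCont (\<lambda>t. b + c * t) 0" by simp
    from sgn[OF 1 this] show ?thesis by (simp add: algebra_simps power2_eq_square)
  next
    case 2
    have "isCont (\<lambda>t. c) 0" by simp
    from sgn[OF 2(2) this] have "eventually (\<lambda>t. t * (b + t * c) \<ge> 0) (at_right 0)
        \<or> eventually (\<lambda>t. t * (b + t * c) \<le> 0) (at_right 0)"
    proof
      assume "eventually (\<lambda>t. b + t * c \<ge> 0) (at_right 0)"
      with pos have "eventually (\<lambda>t. t * (b + t * c) \<ge> 0) (at_right 0)"
        by eventually_elim simp
      then show ?thesis ..
    next
      assume "eventually (\<lambda>t. b + t * c \<le> 0) (at_right 0)"
      with pos have "eventually (\<lambda>t. t * (b + t * c) \<le> 0) (at_right 0)"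
        by eventually_elim (simp add: mult_nonneg_nonpos)
      then show ?thesis ..
    qed
    then show ?thesis using 2 by (simp add: algebra_simps power2_eq_square)
  next
    case 3
    then show ?thesis by (cases "c \<ge> 0") (auto intro!: always_eventually simp: mult_nonpos_nonneg)
  qed
qed

lemma eventual_maximum_exists:
  fixes h :: "'i \<Rightarrow> 'b \<Rightarrow> real"
  assumes "finite I" "I \<noteq> {}"
    and total: "\<And>i j. i \<in> I \<Longrightarrow> j \<in> I \<Longrightarrow>
      eventually (\<lambda>t. h i t \<le> h j t) F \<or> eventually (\<lambda>t. h j t \<le> h i t) F"
  shows "\<exists>i\<in>I. \<forall>j\<in>I. eventually (\<lambda>t. h j t \<le> h i t) F"
  using assms
proof (induction I rule: finite_ne_induct)
  case (singleton i)
  then show ?case by simp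
next
  case (insert l I)
  then obtain i where i: "i \<in> I" "\<forall>j\<in>I. eventually (\<lambda>t. h j t \<le> h i t) F"
    by (metis insertCI)
  show ?case
  proof (cases "eventually (\<lambda>t. h l t \<le> h i t) F")
    case True
    then show ?thesis using i by blast
  next
    case False
    then have li: "eventually (\<lambda>t. h i t \<le> h l t) F" using insert.prems i(1) by blast
    have "eventually (\<lambda>t. h j t \<le> h l t) F" if "j \<in> I" for j
      using i(2)[rule_format, OF that] li by eventually_elim simp
    then show ?thesis by auto
  qed
qed

lemma quadratic_difference_quotient_tendsto:
  assumes "transpose P = P"
  shows "((\<lambda>t. (quadratic P p (x + t *\<^sub>R v) - quadratic P p x) / t) \<longlongrightarrow> (P *v x + p) \<bullet> v) (at_right 0)"
proof -
  have "((\<lambda>t. (P *v x + p) \<bullet> v + t * (1/2 * (v \<bullet> (P *v v)))) \<longlongrightarrow>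
      (P *v x + p) \<bullet> v + 0 * (1/2 * (v \<bullet> (P *v v)))) (at_right 0)"
    by (intro tendsto_intros)
  moreover have "eventually (\<lambda>t. (P *v x + p) \<bullet> v + t * (1/2 * (v \<bullet> (P *v v)))
      = (quadratic P p (x + t *\<^sub>R v) - quadratic P p x) / t) (at_right 0)"
    unfolding eventually_at_filter
    by (intro always_eventually)
      (auto simp: quadratic_add[OF assms] matrix_vector_mult_scaleR field_simps)
  ultimately show ?thesis by (simp add: tendsto_cong)
qed

text \<open>The piece that realizes the maximum along the ray near \<open>x\<close> shows that the one-sided limit in
  \<^const>\<open>dir_deriv\<close> exists. The piece \<open>j\<close>, which may be a different one, lies above the objective
  and touches it at \<open>x\<close>, so its difference quotients are at least as large.\<close>

lemma dir_deriv_le_piece: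
  fixes P :: "nat \<Rightarrow> real^'n^'n"
  assumes P: "\<And>i. i \<le> k \<Longrightarrow> transpose (P i) = P i" and j: "j \<in> {1..k}"
    and act: "pq_objective k P p \<alpha> x = quadratic (P 0 - P j) (p 0 - p j) x - \<alpha> j"
  shows "dir_deriv (pq_objective k P p \<alpha>) x v \<le> ((P 0 - P j) *v x + (p 0 - p j)) \<bullet> v"
proof -
  define \<psi> where "\<psi> = pq_objective k P p \<alpha>"
  define f where "f i y = quadratic (P 0 - P i) (p 0 - p i) y - \<alpha> i" for i y
  define h where "h i t = quadratic (P i) (p i) (x + t *\<^sub>R v) + \<alpha> i" for i t
  have le: "\<psi> y \<le> f i y" if "i \<in> {1..k}" for i y
  proof -
    have "quadratic (P i) (p i) y + \<alpha> i \<le> Max ((\<lambda>i. quadratic (P i) (p i) y + \<alpha> i) ` {1..k})"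
      using that by (intro Max_ge) auto
    then show ?thesis unfolding \<psi>_def f_def pq_objective_def quadratic_diff by linarith
  qed
  have quot: "((\<lambda>t. (f i (x + t *\<^sub>R v) - f i x) / t) \<longlongrightarrow> ((P 0 - P i) *v x + (p 0 - p i)) \<bullet> v)
      (at_right 0)" if "i \<in> {1..k}" for i
    using quadratic_difference_quotient_tendsto[of "P 0 - P i" "p 0 - p i" x v] P that
    by (simp add: f_def transpose_diff)
  have h_diff: "h i t - h i' t = (h i 0 - h i' 0)
      + ((P i *v x + p i) \<bullet> v - (P i' *v x + p i') \<bullet> v) * t
      + (1/2 * (v \<bullet> (P i *v v)) - 1/2 * (v \<bullet> (P i' *v v))) * t\<^sup>2"
    if "i \<in> {1..k}" "i' \<in> {1..k}" for i i' t
    using that by (simp add: h_def quadratic_add[OF P] matrix_vector_mult_scaleR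
        power2_eq_square algebra_simps)
  have "\<exists>i\<in>{1..k}. \<forall>i'\<in>{1..k}. eventually (\<lambda>t. h i' t \<le> h i t) (at_right 0)"
  proof (rule eventual_maximum_exists)
    fix i i' assume "i \<in> {1..k}" "i' \<in> {1..k}"
    from quadratic_polynomial_eventually_signed[of "h i 0 - h i' 0"
        "(P i *v x + p i) \<bullet> v - (P i' *v x + p i') \<bullet> v"
        "1/2 * (v \<bullet> (P i *v v)) - 1/2 * (v \<bullet> (P i' *v v))"]
    show "eventually (\<lambda>t. h i t \<le> h i' t) (at_right 0) \<or> eventually (\<lambda>t. h i' t \<le> h i t) (at_right 0)"
      unfolding h_diff[OF \<open>i \<in> {1..k}\<close> \<open>i' \<in> {1..k}\<close>, symmetric] by auto
  qed (use j in auto)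
  then obtain i where i: "i \<in> {1..k}"
    and max: "\<And>i'. i' \<in> {1..k} \<Longrightarrow> eventually (\<lambda>t. h i' t \<le> h i t) (at_right 0)" by blast
  have cont: "(h i' \<longlongrightarrow> h i' 0) (at_right 0)" for i'
  proof -
    have "continuous_on UNIV (h i')"
      unfolding h_def
      by (intro continuous_intros continuous_on_compose2[OF continuous_on_quadratic[of UNIV]]) auto
    then show ?thesis by (auto simp: continuous_on intro: tendsto_within_subset)
  qed
  have "h i' 0 \<le> h i 0" if "i' \<in> {1..k}" for i'
    using tendsto_le[OF _ cont cont max[OF that]] by simp
  then have i0: "\<psi> x = f i x"
    using i unfolding \<psi>_def f_def pq_objective_def quadratic_diff
    by (subst Max_eqI[of _ "h i 0"]) (auto simp: h_def)
  have "eventually (\<lambda>t. \<forall>i'\<in>{1..k}. h i' t \<le> h i t) (at_right 0)"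
    using max by (intro eventually_ball_finite) auto
  then have "eventually (\<lambda>t. (f i (x + t *\<^sub>R v) - f i x) / t = (\<psi> (x + t *\<^sub>R v) - \<psi> x) / t) (at_right 0)"
  proof eventually_elim
    case (elim t)
    then have "\<psi> (x + t *\<^sub>R v) = f i (x + t *\<^sub>R v)"
      using i unfolding \<psi>_def f_def pq_objective_def quadratic_diff
      by (subst Max_eqI[of _ "h i t"]) (auto simp: h_def)
    then show ?case using i0 by simp
  qed
  from Lim_transform_eventually[OF quot[OF i] this]
  have lim: "((\<lambda>t. (\<psi> (x + t *\<^sub>R v) - \<psi> x) / t) \<longlongrightarrow> ((P 0 - P i) *v x + (p 0 - p i)) \<bullet> v) (at_right 0)" .
  then have "dir_deriv \<psi> x v = ((P 0 - P i) *v x + (p 0 - p i)) \<bullet> v"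
    unfolding dir_deriv_def by (intro tendsto_Lim) auto
  also have "\<dots> \<le> ((P 0 - P j) *v x + (p 0 - p j)) \<bullet> v"
  proof (rule tendsto_le[OF _ quot[OF j] lim])
    have "f j x = \<psi> x" using act by (simp add: f_def \<psi>_def)
    then show "eventually (\<lambda>t. (\<psi> (x + t *\<^sub>R v) - \<psi> x) / t \<le> (f j (x + t *\<^sub>R v) - f j x) / t) (at_right 0)"
      unfolding eventually_at_filter using le[OF j]
      by (intro always_eventually) (auto intro!: divide_right_mono)
  qed simp
  finally show ?thesis by (simp add: \<psi>_def)
qed

section \<open>Faces of a polyhedron\<close>

definition active_rows :: "real^'n^'m \<Rightarrow> real^'m \<Rightarrow> real^'n \<Rightarrow> 'm set" where
  "active_rows A b x = {i. row i A \<bullet> x = b $ i}"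

definition face_directions :: "real^'n^'m \<Rightarrow> 'm set \<Rightarrow> (real^'n) set" where
  "face_directions A I = {v. \<forall>i\<in>I. row i A \<bullet> v = 0}"

lemma subspace_face_directions: "subspace (face_directions A I)"
  by (auto simp: subspace_def face_directions_def inner_add_right)

lemma diff_in_face_directions:
  assumes "active_rows A b x = I" "active_rows A b y = I"
  shows "y - x \<in> face_directions A I"
  using assms by (auto simp: active_rows_def face_directions_def inner_diff_right)

lemma polyhedral_set_row: "x \<in> polyhedral_set A b \<longleftrightarrow> (\<forall>i. row i A \<bullet> x \<le> b $ i)"
  by (simp add: polyhedral_set_def row_def inner_vec_def matrix_vector_mult_def)

lemma face_direction_stays_in_polyhedral_set:
  assumes x: "x \<in> polyhedral_set A b" and v: "v \<in> face_directions A (active_rows A b x)"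
  shows "\<exists>\<epsilon>>0. \<forall>t. \<bar>t\<bar> < \<epsilon> \<longrightarrow> x + t *\<^sub>R v \<in> polyhedral_set A b"
proof -
  have "eventually (\<lambda>t. row i A \<bullet> (x + t *\<^sub>R v) \<le> b $ i) (nhds 0)" for i
  proof (cases "i \<in> active_rows A b x")
    case True
    then show ?thesis using v by (simp add: active_rows_def face_directions_def inner_add_right)
  next
    case False
    then have lt: "row i A \<bullet> (x + 0 *\<^sub>R v) < b $ i"
      using x by (auto simp: active_rows_def polyhedral_set_row less_le)
    have "((\<lambda>t. row i A \<bullet> (x + t *\<^sub>R v)) \<longlongrightarrow> row i A \<bullet> (x + 0 *\<^sub>R v)) (nhds 0)"
      by (intro tendsto_intros filterlim_ident)
    from order_tendstoD(2)[OF this lt] show ?thesis by (auto elim: eventually_mono)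
  qed
  then have "eventually (\<lambda>t. \<forall>i. row i A \<bullet> (x + t *\<^sub>R v) \<le> b $ i) (nhds 0)"
    by (rule eventually_all_finite)
  then show ?thesis by (auto simp: eventually_nhds_metric polyhedral_set_row)
qed

lemma segment_direction_in_tangent_cone:
  assumes "\<epsilon> > 0" "\<And>t. 0 < t \<Longrightarrow> t < \<epsilon> \<Longrightarrow> x + t *\<^sub>R v \<in> X"
  shows "v \<in> tangent_cone x X"
proof -
  define \<tau> where "\<tau> k = (\<epsilon> / 2) * inverse (real (Suc k))" for k
  have pos: "\<tau> k > 0" and lt: "\<tau> k < \<epsilon>" for k
    using assms(1) by (auto simp: \<tau>_def field_simps add_pos_nonneg)
  have lim: "\<tau> \<longlonglongrightarrow> 0"
    unfolding \<tau>_def using tendsto_mult[OF tendsto_const LIMSEQ_inverse_real_of_nat] by fastforce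
  have "(\<lambda>k. x + \<tau> k *\<^sub>R v) \<longlonglongrightarrow> x + 0 *\<^sub>R v"
    by (intro tendsto_intros lim)
  moreover have "(\<lambda>k. (x + \<tau> k *\<^sub>R v - x) /\<^sub>R \<tau> k) = (\<lambda>k. v)"
    using pos by (simp add: less_imp_neq[THEN not_sym] fun_eq_iff)
  ultimately show ?thesis
    unfolding tangent_cone_def using pos lt lim assms(2)
    by (intro CollectI exI[of _ "\<lambda>k. x + \<tau> k *\<^sub>R v"] exI[of _ \<tau>]) auto
qed

section \<open>Finitely many stationary values\<close>

text \<open>The linearization cone contains \<open>v\<close> and \<open>-v\<close> whenever \<open>v\<close> is orthogonal to all active
  gradients, so \<open>P *v x + p\<close> is orthogonal to \<open>v\<close> and the multiplier rule applies.\<close>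

lemma finite_values_on_face_if_Abadie:
  fixes P Q :: "real^'n^'n"
  assumes P: "transpose P = P" and Q: "transpose Q = Q"
  shows "finite {quadratic P p x | x. active_rows A b x = I
    \<and> (\<forall>v\<in>linearization_cone Q c \<beta>1 \<beta>2 A b x. (P *v x + p) \<bullet> v \<ge> 0)}"
    (is "finite {quadratic P p x | x. ?S x}")
proof (cases "\<exists>x. ?S x")
  case True
  then obtain x0 where x0: "active_rows A b x0 = I" by blast
  define V where "V = face_directions A I"
  have V: "subspace V" unfolding V_def by (rule subspace_face_directions)
  obtain B where B: "B \<subseteq> V" "independent B" "V = span B"
    using basis_subspace_exists[OF V] by metis
  have finB: "finite B" using B(2) by (rule finiteI_independent)
  \<comment> \<open>The case without an active bound on \<open>quadratic Q c\<close> is the one where the quadric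
    \<open>quadratic 0 0 x = 0\<close> is the whole space. An infinite bound is never active;
    \<^const>\<open>real_of_ereal\<close> sends it to the default level \<open>0\<close>.\<close>
  define crit where "crit R r \<beta> = {quadratic P p x | x \<mu>. x - x0 \<in> span B \<and> quadratic R r x = \<beta>
    \<and> (\<forall>v\<in>span B. (P *v x + p + \<mu> *\<^sub>R (R *v x + r)) \<bullet> v = 0)}" for R r \<beta>
  have fin: "finite (crit R r \<beta>)" if "transpose R = R" for R r \<beta>
    unfolding crit_def by (rule finite_critical_values_on_quadric[OF P that finB])
  have "quadratic P p x \<in> crit Q c (real_of_ereal \<beta>1) \<union> crit Q c (real_of_ereal \<beta>2) \<union> crit 0 0 0"
    if x: "?S x" for x
  proof -
    have xV: "x - x0 \<in> span B" using x x0 diff_in_face_directions B(3) V_def by blast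
    have zero: "(P *v x + p) \<bullet> v = 0"
      if v: "v \<in> V" and g: "ereal (quadratic Q c x) = \<beta>1 \<or> ereal (quadratic Q c x) = \<beta>2
        \<Longrightarrow> (Q *v x + c) \<bullet> v = 0" for v
    proof -
      have "v \<in> linearization_cone Q c \<beta>1 \<beta>2 A b x" "- v \<in> linearization_cone Q c \<beta>1 \<beta>2 A b x"
        using v g x
        by (auto simp: linearization_cone_def V_def face_directions_def active_rows_def inner_commute)
      then have "(P *v x + p) \<bullet> v \<ge> 0" "(P *v x + p) \<bullet> (- v) \<ge> 0" using x by blast+
      then show ?thesis by simp
    qed
    show ?thesis
    proof (cases "ereal (quadratic Q c x) = \<beta>1 \<or> ereal (quadratic Q c x) = \<beta>2")
      case True
      obtain \<mu> where \<mu>: "\<forall>v\<in>V. (P *v x + p + \<mu> *\<^sub>R (Q *v x + c)) \<bullet> v = 0"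
        using multiplier_exists[OF V, of "Q *v x + c" "P *v x + p"] zero by blast
      have "quadratic Q c x = real_of_ereal \<beta>1 \<or> quadratic Q c x = real_of_ereal \<beta>2"
        using True by (metis real_of_ereal.simps(1))
      with \<mu> xV show ?thesis unfolding crit_def B(3) by blast
    next
      case False
      then have "\<forall>v\<in>span B. (P *v x + p + 0 *\<^sub>R (0 *v x + 0)) \<bullet> v = 0"
        using zero B(3) by simp
      moreover have "quadratic 0 0 x = 0" by (simp add: quadratic_def)
      ultimately show ?thesis using xV unfolding crit_def by blast
    qed
  qed
  then have "{quadratic P p x | x. ?S x}
      \<subseteq> crit Q c (real_of_ereal \<beta>1) \<union> crit Q c (real_of_ereal \<beta>2) \<union> crit 0 0 0"
    by blast
  moreover have "transpose (0 :: real^'n^'n) = 0" by (simp add: transpose_def vec_eq_iff)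
  ultimately show ?thesis using fin Q by (meson finite_UnI finite_subset)
next
  case False
  then have "{quadratic P p x | x. ?S x} = {}" by blast
  then show ?thesis by (simp only: finite.emptyI)
qed

text \<open>For a minimizer \<open>x\<close> of \<open>quadratic Q c\<close> the gradient \<open>Q *v x + c\<close> is orthogonal to all
  directions of its face. Subtracting this at \<open>x\<close> and \<open>y\<close> shows the same of \<open>Q *v (y - x)\<close>, so
  \<open>quadratic Q c\<close> does not change along \<open>y - x\<close>, to first and to second order, and a segment around
  each of the two points on this line is feasible. A quadratic function whose derivative along a
  segment vanishes at both ends has equal values there.\<close>

lemma equal_values_on_face_of_minimizers:
  fixes P Q :: "real^'n^'n"
  assumes P: "transpose P = P" and Q: "transpose Q = Q"
    and min: "\<And>z. z \<in> polyhedral_set A b \<Longrightarrow> \<beta> \<le> quadratic Q c z"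
    and X: "X = {z \<in> polyhedral_set A b. quadratic Q c z = \<beta>}"
    and x: "x \<in> X" "\<And>v. v \<in> tangent_cone x X \<Longrightarrow> (P *v x + p) \<bullet> v \<ge> 0"
    and y: "y \<in> X" "\<And>v. v \<in> tangent_cone y X \<Longrightarrow> (P *v y + p) \<bullet> v \<ge> 0"
    and I: "active_rows A b x = I" "active_rows A b y = I"
  shows "quadratic P p x = quadratic P p y"
proof -
  define V where "V = face_directions A I"
  define h where "h = y - x"
  have hV: "h \<in> V" unfolding h_def V_def by (rule diff_in_face_directions[OF I])
  have line: "quadratic Q c (z + t *\<^sub>R v) = quadratic Q c z + ((Q *v z + c) \<bullet> v) * t
      + (1/2 * (v \<bullet> (Q *v v))) * t\<^sup>2" for z t v
    by (simp add: quadratic_add[OF Q] matrix_vector_mult_scaleR power2_eq_square)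
  have grad: "(Q *v z + c) \<bullet> v = 0"
    if z: "z \<in> X" "active_rows A b z = I" and v: "v \<in> V" for z v
  proof -
    obtain \<epsilon> where \<epsilon>: "\<epsilon> > 0" "\<And>t. \<bar>t\<bar> < \<epsilon> \<Longrightarrow> z + t *\<^sub>R v \<in> polyhedral_set A b"
      using face_direction_stays_in_polyhedral_set[of z A b v] z v X V_def by auto
    have "((\<lambda>t. quadratic Q c (z + t *\<^sub>R v)) has_real_derivative (Q *v z + c) \<bullet> v) (at 0)"
      unfolding line by (auto intro!: derivative_eq_intros)
    then show ?thesis
      by (rule DERIV_local_min[OF _ \<epsilon>(1)]) (use \<epsilon>(2) min z(1) X in auto)
  qed
  have "(Q *v h) \<bullet> v = 0" if "v \<in> V" for v
    using grad[OF x(1) I(1) that] grad[OF y(1) I(2) that]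
    by (simp add: h_def matrix_vector_mult_diff_distrib inner_diff_left inner_add_left)
  then have hQh: "h \<bullet> (Q *v h) = 0" using hV by (simp add: inner_commute)
  have tangent: "v \<in> tangent_cone z X"
    if z: "z \<in> X" "active_rows A b z = I" and v: "v = h \<or> v = - h" for z v
  proof -
    have vV: "v \<in> V" using v hV subspace_neg[OF subspace_face_directions] V_def by blast
    then obtain \<epsilon> where \<epsilon>: "\<epsilon> > 0" "\<And>t. \<bar>t\<bar> < \<epsilon> \<Longrightarrow> z + t *\<^sub>R v \<in> polyhedral_set A b"
      using face_direction_stays_in_polyhedral_set[of z A b v] z X V_def by auto
    have "v \<bullet> (Q *v v) = 0"
      using v hQh matrix_vector_mult_scaleR[of Q "-1" h] by auto
    then have "quadratic Q c (z + t *\<^sub>R v) = \<beta>" for t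
      using grad[OF z vV] z X by (simp add: line)
    then show ?thesis
      using \<epsilon> X by (intro segment_direction_in_tangent_cone[OF \<epsilon>(1)]) auto
  qed
  have x0: "(P *v x + p) \<bullet> h = 0"
    using x(2)[OF tangent[OF x(1) I(1), of h]] x(2)[OF tangent[OF x(1) I(1), of "- h"]] by simp
  have y0: "(P *v y + p) \<bullet> h = 0"
    using y(2)[OF tangent[OF y(1) I(2), of h]] y(2)[OF tangent[OF y(1) I(2), of "- h"]] by simp
  have "quadratic P p y = quadratic P p x + 1/2 * (h \<bullet> (P *v h))"
    using quadratic_add[OF P, of p x h] x0 by (simp add: h_def)
  moreover have x_eq: "x = y + - h" by (simp add: h_def)
  have "quadratic P p x = quadratic P p y + 1/2 * (h \<bullet> (P *v h))"
    unfolding x_eq quadratic_add[OF P] using y0 matrix_vector_mult_scaleR[of P "-1" h] by simp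
  ultimately show ?thesis by simp
qed

theorem proposition13:
  fixes P :: "nat \<Rightarrow> real^'n^'n" and p :: "nat \<Rightarrow> real^'n" and \<alpha> :: "nat \<Rightarrow> real"
    and k2 :: nat
    and Q :: "real^'n^'n" and c :: "real^'n" and \<beta>1 \<beta>2 :: ereal
    and A :: "real^'n^'m" and b :: "real^'m"
  defines "\<psi> \<equiv> pq_objective k2 P p \<alpha>"
    and "X \<equiv> feasible_set Q c \<beta>1 \<beta>2 A b"
    and "Z \<equiv> polyhedral_set A b"
  assumes "k2 \<ge> 1"
    and "\<And>i. i \<le> k2 \<Longrightarrow> transpose (P i) = P i"
    and "transpose Q = Q"
    and "\<beta>1 \<le> \<beta>2" and "\<beta>1 \<noteq> \<infinity>" and "\<beta>2 \<noteq> -\<infinity>"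
    and "(\<forall>x. B_stationary \<psi> X x \<longrightarrow> Abadie_CQ Q c \<beta>1 \<beta>2 A b x)
       \<or> ((\<nexists>x. x \<in> Z \<and> ereal (quadratic Q c x) > \<beta>1)
          \<or> (\<nexists>x. x \<in> Z \<and> ereal (quadratic Q c x) < \<beta>2))"
  shows "finite (B_stationary_values \<psi> X)"
proof -
  define f where "f j = quadratic (P 0 - P j) (p 0 - p j)" for j
  define w where "w j x = (P 0 - P j) *v x + (p 0 - p j)" for j x
  have sym: "transpose (P 0 - P j) = P 0 - P j" if "j \<in> {1..k2}" for j
    using assms(5) that by (simp add: transpose_diff)
  define S where "S j I = {x. B_stationary \<psi> X x \<and> \<psi> x = f j x - \<alpha> j \<and> active_rows A b x = I}" for j I
  have stat: "w j x \<bullet> v \<ge> 0"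
    if "x \<in> S j I" "j \<in> {1..k2}" "v \<in> tangent_cone x X" for j I x v
  proof -
    have "0 \<le> dir_deriv \<psi> x v" using that by (auto simp: S_def B_stationary_def)
    also have "\<dots> \<le> w j x \<bullet> v"
      unfolding \<psi>_def w_def
      by (rule dir_deriv_le_piece) (use that assms(5) in \<open>auto simp: S_def \<psi>_def f_def\<close>)
    finally show ?thesis .
  qed
  have piece: "\<exists>j\<in>{1..k2}. \<psi> x = f j x - \<alpha> j" for x
  proof -
    have "Max ((\<lambda>i. quadratic (P i) (p i) x + \<alpha> i) ` {1..k2})
        \<in> (\<lambda>i. quadratic (P i) (p i) x + \<alpha> i) ` {1..k2}"
      using assms(4) by (intro Max_in) auto
    then obtain j where "j \<in> {1..k2}"
      "Max ((\<lambda>i. quadratic (P i) (p i) x + \<alpha> i) ` {1..k2}) = quadratic (P j) (p j) x + \<alpha> j"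
      by blast
    then show ?thesis
      unfolding \<psi>_def pq_objective_def f_def quadratic_diff by (intro bexI[of _ j]) linarith+
  qed
  \<comment> \<open>Stated for \<open>R\<close>, \<open>r\<close> because a feasible set of maximizers is handled with \<open>- Q\<close>, \<open>- c\<close>.\<close>
  have collapse: "finite (f j ` S j I)"
    if R: "transpose R = R"
      and min: "\<And>z. z \<in> polyhedral_set A b \<Longrightarrow> \<beta> \<le> quadratic R r z"
      and X: "X = {z \<in> polyhedral_set A b. quadratic R r z = \<beta>}"
      and j: "j \<in> {1..k2}" for R r \<beta> j I
  proof -
    have "f j x = f j y" if "x \<in> S j I" "y \<in> S j I" for x y
      unfolding f_def
      by (rule equal_values_on_face_of_minimizers[OF sym[OF j] R min X, where I=I])
        (use that stat[OF that(1) j] stat[OF that(2) j] in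
          \<open>auto simp: S_def B_stationary_def w_def\<close>)
    then have "\<exists>t. f j ` S j I \<subseteq> {t}" by blast
    then show ?thesis using finite_subset by blast
  qed
  have fin: "finite (f j ` S j I)" if j: "j \<in> {1..k2}" for j I
    using assms(10)
  proof (elim disjE)
    assume a: "\<forall>x. B_stationary \<psi> X x \<longrightarrow> Abadie_CQ Q c \<beta>1 \<beta>2 A b x"
    have "f j ` S j I \<subseteq> {f j x | x. active_rows A b x = I
        \<and> (\<forall>v\<in>linearization_cone Q c \<beta>1 \<beta>2 A b x. w j x \<bullet> v \<ge> 0)}"
    proof safe
      fix x assume x: "x \<in> S j I"
      then have "tangent_cone x X = linearization_cone Q c \<beta>1 \<beta>2 A b x"
        using a by (simp add: S_def Abadie_CQ_def X_def)
      then show "\<exists>x'. f j x = f j x' \<and> active_rows A b x' = I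
        \<and> (\<forall>v\<in>linearization_cone Q c \<beta>1 \<beta>2 A b x'. w j x' \<bullet> v \<ge> 0)"
        using stat[OF x j] x by (intro exI[of _ x]) (auto simp: S_def)
    qed
    then show ?thesis
      using finite_values_on_face_if_Abadie[OF sym[OF j] assms(6)]
      unfolding f_def w_def by (rule finite_subset)
  next
    assume "\<nexists>x. x \<in> Z \<and> ereal (quadratic Q c x) > \<beta>1"
    then have le: "ereal (quadratic Q c z) \<le> \<beta>1" if "z \<in> polyhedral_set A b" for z
      using that Z_def by force
    \<comment> \<open>For \<open>\<beta>1 = -\<infinity>\<close> the hypothesis says that the polyhedron is empty.\<close>
    have "X = {} \<or> (\<exists>\<beta>. \<beta>1 = ereal \<beta>)"
      using le assms(8) by (cases \<beta>1) (auto simp: X_def feasible_set_def)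
    then show ?thesis
    proof
      assume "X = {}"
      then show ?thesis by (simp add: S_def B_stationary_def)
    next
      assume "\<exists>\<beta>. \<beta>1 = ereal \<beta>"
      then obtain \<beta> where \<beta>: "\<beta>1 = ereal \<beta>" by blast
      have neg: "quadratic (- Q) (- c) z = - quadratic Q c z" for z
        using quadratic_diff[of 0 Q 0 c z] by (simp add: quadratic_def)
      have "X = {z \<in> polyhedral_set A b. quadratic Q c z = \<beta>}"
        using le assms(7) \<beta> by (force simp: X_def feasible_set_def)
      then show ?thesis
        using le \<beta> assms(6) transpose_diff[of 0 Q]
        by (intro collapse[of "- Q" "- \<beta>" "- c", OF _ _ _ j]) (auto simp: neg transpose_def vec_eq_iff)
    qed
  next
    assume "\<nexists>x. x \<in> Z \<and> ereal (quadratic Q c x) < \<beta>2"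
    then have ge: "\<beta>2 \<le> ereal (quadratic Q c z)" if "z \<in> polyhedral_set A b" for z
      using that Z_def by force
    have "X = {} \<or> (\<exists>\<beta>. \<beta>2 = ereal \<beta>)"
      using ge assms(9) by (cases \<beta>2) (auto simp: X_def feasible_set_def)
    then show ?thesis
    proof
      assume "X = {}"
      then show ?thesis by (simp add: S_def B_stationary_def)
    next
      assume "\<exists>\<beta>. \<beta>2 = ereal \<beta>"
      then obtain \<beta> where \<beta>: "\<beta>2 = ereal \<beta>" by blast
      have "X = {z \<in> polyhedral_set A b. quadratic Q c z = \<beta>}"
        using ge assms(7) \<beta> by (force simp: X_def feasible_set_def)
      then show ?thesis
        using ge \<beta> assms(6) by (intro collapse[of Q \<beta> c, OF _ _ _ j]) auto
    qed
  qed
  have "B_stationary_values \<psi> X \<subseteq> (\<Union>j\<in>{1..k2}. \<Union>I. (\<lambda>t. t - \<alpha> j) ` (f j ` S j I))"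
    using piece by (fastforce simp: B_stationary_values_def S_def)
  moreover have "finite (\<Union>j\<in>{1..k2}. \<Union>I. (\<lambda>t. t - \<alpha> j) ` (f j ` S j I))"
    using finite_imageI[OF fin] by (intro finite_UN_I) auto
  ultimately show ?thesis by (rule finite_subset)
qed

end
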